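(* Let $H\ge1$, $m\ge1$ be integers, let $\Phi\in\mathbb{R}^{|\mathcal S|\times d}$ be a feature matrix (row $s$ is $\phi(s)^\top$), and let $\mathcal D\subseteq\mathcal S$ be a fixed set of states such that the submatrix $\Phi_{\mathcal D}$ (rows of $\Phi$ indexed by $\mathcal D$) has rank $d$. Let $\mathcal P\in\{0,1\}^{|\mathcal D|\times|\mathcal S|}$ be the matrix selecting the coordinates in $\mathcal D$ (in the same order as the rows of $\Phi_{\mathcal D}$), and $\mathcal M:=\Phi(\Phi_{\mathcal D}^\top\Phi_{\mathcal D})^{-1}\Phi_{\mathcal D}^\top\mathcal P$. Given $\theta_0\in\mathbb{R}^d$, define iteratively: let $(\mu_{k+1},\nu_{k+1})$ be any pair of stationary randomized policies with $T_{\mu_{k+1},\nu_{k+1}}(T^{H-1}\Phi\theta_k)=T^H\Phi\theta_k$, and let $\theta_{k+1}$ be the least-squares solution $$\theta_{k+1}=\arg\min_\theta\sum_{s\in\mathcal D}\Big((\Phi\theta)(s)-\big(T^m_{\mu_{k+1},\nu_{k+1}}T^{H-1}\Phi\theta_k\big)(s)\Big)^2,$$ so that $\Phi\theta_{k+1}=\mathcal M\,T^m_{\mu_{k+1},\nu_{k+1}}T^{H-1}\Phi\theta_k$. Let $\delta_{FV}:=\|\mathcal M\|_\infty$ (induced $\infty$-norm) and $\delta_{app}:=\sup_{k\ge1}\|J^{\mu_k,\nu_k}-\mathcal M J^{\mu_k,\nu_k}\|_\infty$, and suppose $$\kappa:=\alpha^{H-1}+\frac{(\delta_{FV}\alpha^{m+H-1}+\alpha^{H-1})(1+\alpha)}{1-\alpha}<1.$$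 Then for all $k\ge0$, $$\|\Phi\theta_k-J^*\|_\infty\le\kappa^k\|\Phi\theta_0-J^*\|_\infty+\frac{\delta_{app}}{1-\kappa},$$ and hence $\limsup_{k\to\infty}\|\Phi\theta_k-J^*\|_\infty\le\frac{\delta_{app}}{1-\kappa}$.
   Context: A two-player zero-sum discounted Markov game has a finite state space $\mathcal S$, finite action sets $\mathcal U(s)$ (maximizer) and $\mathcal V(s)$ (minimizer) at each state $s$, transition probabilities $P(s'|s,u,v)$, reward $g(s,u,v)\in[0,1]$, and discount factor $\alpha\in(0,1)$. A (stationary randomized) policy pair $(\mu,\nu)$ assigns to each $s$ distributions $\mu(s)\in\Delta(\mathcal U(s))$, $\nu(s)\in\Delta(\mathcal V(s))$. For $V\in\mathbb{R}^{|\mathcal S|}$ and $s\in\mathcal S$ let $A_{V,s}(u,v)=g(s,u,v)+\alpha\sum_{s'}P(s'|s,u,v)V(s')$. Define $T_{\mu,\nu}V(s)=\mu(s)^\top A_{V,s}\nu(s)$ and the Bellman operator $TV(s)=\max_{p\in\Delta(\mathcal U(s))}\min_{q\in\Delta(\mathcal V(s))}p^\top A_{V,s}q$. $J^{\mu,\nu}$ is the unique fixed point of $T_{\mu,\nu}$ and $J^*$ the unique fixed point of $T$ (the Nash equilibrium value). $T^j$, $T^j_{\mu,\nu}$ denote $j$-fold compositions, $T^0$ the identity. *)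

theory Defs
  imports "HOL-Analysis.Analysis"
begin

section \<open>Two-player zero-sum discounted Markov games\<close>

text \<open>Value functions are vectors indexed by the finite state type 's.
  Action sets are given state-wise: Uset s (maximizer), Vset s (minimizer).
  Transition probabilities: Pr s u v s'.  Reward: g s u v.\<close>

definition markov_game ::
  "('s::finite \<Rightarrow> 'u set) \<Rightarrow> ('s \<Rightarrow> 'v set) \<Rightarrow> ('s \<Rightarrow> 'u \<Rightarrow> 'v \<Rightarrow> 's \<Rightarrow> real)
   \<Rightarrow> ('s \<Rightarrow> 'u \<Rightarrow> 'v \<Rightarrow> real) \<Rightarrow> real \<Rightarrow> bool" where
  "markov_game Uset Vset Pr g \<alpha> \<longleftrightarrow>
     0 < \<alpha> \<and> \<alpha> < 1 \<and>
     (\<forall>s. finite (Uset s) \<and> Uset s \<noteq> {} \<and> finite (Vset s) \<and> Vset s \<noteq> {}) \<and>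
     (\<forall>s. \<forall>u\<in>Uset s. \<forall>v\<in>Vset s.
        (\<forall>s'. 0 \<le> Pr s u v s') \<and> (\<Sum>s'\<in>UNIV. Pr s u v s') = 1 \<and>
        0 \<le> g s u v \<and> g s u v \<le> 1)"

text \<open>Probability distributions on a finite set A, as weight functions.\<close>
definition prob_simplex :: "'a set \<Rightarrow> ('a \<Rightarrow> real) set" where
  "prob_simplex A = {p. (\<forall>a. 0 \<le> p a) \<and> (\<forall>a. a \<notin> A \<longrightarrow> p a = 0) \<and> (\<Sum>a\<in>A. p a) = 1}"

text \<open>Stationary randomized policy pair.\<close>
definition policy_pair ::
  "('s \<Rightarrow> 'u set) \<Rightarrow> ('s \<Rightarrow> 'v set) \<Rightarrow> ('s \<Rightarrow> 'u \<Rightarrow> real) \<Rightarrow> ('s \<Rightarrow> 'v \<Rightarrow> real) \<Rightarrow> bool" where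
  "policy_pair Uset Vset \<mu> \<nu> \<longleftrightarrow> (\<forall>s. \<mu> s \<in> prob_simplex (Uset s) \<and> \<nu> s \<in> prob_simplex (Vset s))"

text \<open>The stage matrix A_{V,s}(u,v).\<close>
definition Amat ::
  "('s::finite \<Rightarrow> 'u \<Rightarrow> 'v \<Rightarrow> 's \<Rightarrow> real) \<Rightarrow> ('s \<Rightarrow> 'u \<Rightarrow> 'v \<Rightarrow> real) \<Rightarrow> real
   \<Rightarrow> real^'s \<Rightarrow> 's \<Rightarrow> 'u \<Rightarrow> 'v \<Rightarrow> real" where
  "Amat Pr g \<alpha> J s u v = g s u v + \<alpha> * (\<Sum>s'\<in>UNIV. Pr s u v s' * J $ s')"

text \<open>Bilinear form p^T A q over the action sets at state s.\<close>
definition bilin ::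
  "'u set \<Rightarrow> 'v set \<Rightarrow> ('u \<Rightarrow> real) \<Rightarrow> ('u \<Rightarrow> 'v \<Rightarrow> real) \<Rightarrow> ('v \<Rightarrow> real) \<Rightarrow> real" where
  "bilin U V p A q = (\<Sum>u\<in>U. \<Sum>v\<in>V. p u * A u v * q v)"

text \<open>T_{mu,nu}\<close>
definition Tpol ::
  "('s::finite \<Rightarrow> 'u set) \<Rightarrow> ('s \<Rightarrow> 'v set) \<Rightarrow> ('s \<Rightarrow> 'u \<Rightarrow> 'v \<Rightarrow> 's \<Rightarrow> real)
   \<Rightarrow> ('s \<Rightarrow> 'u \<Rightarrow> 'v \<Rightarrow> real) \<Rightarrow> real
   \<Rightarrow> ('s \<Rightarrow> 'u \<Rightarrow> real) \<Rightarrow> ('s \<Rightarrow> 'v \<Rightarrow> real) \<Rightarrow> real^'s \<Rightarrow> real^'s" where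
  "Tpol Uset Vset Pr g \<alpha> \<mu> \<nu> J =
     (\<chi> s. bilin (Uset s) (Vset s) (\<mu> s) (Amat Pr g \<alpha> J s) (\<nu> s))"

text \<open>Bellman (Shapley) operator T: max over p, min over q.\<close>
definition Tbell ::
  "('s::finite \<Rightarrow> 'u set) \<Rightarrow> ('s \<Rightarrow> 'v set) \<Rightarrow> ('s \<Rightarrow> 'u \<Rightarrow> 'v \<Rightarrow> 's \<Rightarrow> real)
   \<Rightarrow> ('s \<Rightarrow> 'u \<Rightarrow> 'v \<Rightarrow> real) \<Rightarrow> real \<Rightarrow> real^'s \<Rightarrow> real^'s" where
  "Tbell Uset Vset Pr g \<alpha> J =
     (\<chi> s. SUP p\<in>prob_simplex (Uset s). INF q\<in>prob_simplex (Vset s).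
              bilin (Uset s) (Vset s) p (Amat Pr g \<alpha> J s) q)"

text \<open>J^{mu,nu}: the unique fixed point of T_{mu,nu}; J^*: the unique fixed point of T.\<close>
definition Jpol where
  "Jpol Uset Vset Pr g \<alpha> \<mu> \<nu> = (THE J. Tpol Uset Vset Pr g \<alpha> \<mu> \<nu> J = J)"

definition Jstar where
  "Jstar Uset Vset Pr g \<alpha> = (THE J. Tbell Uset Vset Pr g \<alpha> J = J)"

section \<open>Norms\<close>

definition supnorm :: "real^'n::finite \<Rightarrow> real" where
  "supnorm x = (MAX i\<in>UNIV. \<bar>x $ i\<bar>)"

text \<open>Operator norm induced by the infinity norm.\<close>
definition induced_supnorm :: "real^'n::finite^'m::finite \<Rightarrow> real" where
  "induced_supnorm A = (SUP x\<in>{x. supnorm x \<le> 1}. supnorm (A *v x))"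

section \<open>Feature matrix restricted to D\<close>

text \<open>Phi_D, written as an 's x 'd matrix whose rows outside D are zero.
  Then transpose (Phi_D0) ** Phi_D0 = Phi_D^T Phi_D, transpose (Phi_D0) = Phi_D^T P,
  and rank Phi_D0 = rank Phi_D.\<close>
definition restrict_rows :: "'s set \<Rightarrow> real^'d^'s \<Rightarrow> real^'d^'s" where
  "restrict_rows D \<Phi> = (\<chi> s. if s \<in> D then \<Phi> $ s else 0)"

definition Mproj :: "'s::finite set \<Rightarrow> real^'d::finite^'s \<Rightarrow> real^'s^'s" where
  "Mproj D \<Phi> = \<Phi> ** matrix_inv (transpose (restrict_rows D \<Phi>) ** restrict_rows D \<Phi>)
                 ** transpose (restrict_rows D \<Phi>)"

end

theory Submission
  imports Defs
begin

text \<open>The Bellman operator T and every policy operator T_{\<mu>,\<nu>} are \<alpha>-contractions for the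
  sup norm, so J* and J^{\<mu>,\<nu>} exist as their fixed points. Because the rows of \<Phi> indexed by D
  have full column rank, the least-squares condition pins down
  \<Phi>\<theta>_{k+1} = M T_{\<mu>,\<nu>}^m W with W = T^{H-1} \<Phi>\<theta>_k and (\<mu>,\<nu>) greedy for W.
  Greediness gives (1-\<alpha>) |J^{\<mu>,\<nu>} - J*| \<le> 2\<alpha> |W - J*|, and splitting
  \<Phi>\<theta>_{k+1} - J* = M (T_{\<mu>,\<nu>}^m W - T_{\<mu>,\<nu>}^m J^{\<mu>,\<nu>}) + (M J^{\<mu>,\<nu>} - J^{\<mu>,\<nu>}) + (J^{\<mu>,\<nu>} - J*)
  together with |W - J*| \<le> \<alpha>^{H-1} |\<Phi>\<theta>_k - J*| yields the affine recursion
  e_{k+1} \<le> \<kappa> e_k + \<delta>_app for the errors, which unrolls to the claimed bound.\<close>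

lemma funpow_fixpoint: "f x = x \<Longrightarrow> (f ^^ n) x = x"
  by (induction n) simp_all

lemma supnorm_eq_infnorm: "supnorm x = infnorm x"
  unfolding supnorm_def infnorm_cart by (simp add: cSup_eq_Max full_SetCompr_eq)

lemma infnorm_funpow_le:
  fixes f :: "'a::euclidean_space \<Rightarrow> 'a"
  assumes lip: "\<And>x y. infnorm (f x - f y) \<le> c * infnorm (x - y)" and "0 \<le> c"
  shows "infnorm ((f ^^ n) x - (f ^^ n) y) \<le> c ^ n * infnorm (x - y)"
proof (induction n)
  case (Suc n)
  have "infnorm ((f ^^ Suc n) x - (f ^^ Suc n) y) \<le> c * infnorm ((f ^^ n) x - (f ^^ n) y)"
    using lip by simp
  also have "\<dots> \<le> c * (c ^ n * infnorm (x - y))"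
    using Suc \<open>0 \<le> c\<close> by (rule mult_left_mono)
  finally show ?case by simp
qed simp

text \<open>Some iterate of an infnorm-contraction is a contraction for the Euclidean norm,
  since the two norms differ at most by the factor sqrt DIM('a).\<close>
lemma infnorm_contraction_unique_fixpoint:
  fixes f :: "'a::euclidean_space \<Rightarrow> 'a"
  assumes lip: "\<And>x y. infnorm (f x - f y) \<le> c * infnorm (x - y)" and c: "0 \<le> c" "c < 1"
  shows "\<exists>!x. f x = x"
proof -
  let ?K = "sqrt DIM('a)"
  obtain n where "c ^ n < 1 / ?K"
    using real_arch_pow_inv[of "1 / ?K" c] c by auto
  then have Kn: "?K * c ^ n < 1" by (simp add: field_simps)
  define F where "F = f ^^ n"
  have "dist (F x) (F y) \<le> (?K * c ^ n) * dist x y" for x y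
  proof -
    have "dist (F x) (F y) \<le> ?K * infnorm (F x - F y)"
      by (simp add: dist_norm norm_le_infnorm)
    also have "\<dots> \<le> ?K * (c ^ n * infnorm (x - y))"
      unfolding F_def by (intro mult_left_mono infnorm_funpow_le[OF lip c(1)]) simp
    also have "\<dots> \<le> ?K * (c ^ n * dist x y)"
      using c by (intro mult_left_mono) (simp_all add: dist_norm infnorm_le_norm)
    finally show ?thesis by (simp add: mult.assoc)
  qed
  then have "\<exists>!x. F x = x"
    using Kn c by (intro banach_fix_type) auto
  then obtain x where x: "F x = x" and unique: "\<And>y. F y = y \<Longrightarrow> y = x"
    by blast
  have "F (f x) = f x"
    using x unfolding F_def by (metis funpow_swap1)
  then have "f x = x" by (rule unique)
  moreover have "y = x" if "f y = y" for y
    using unique funpow_fixpoint[of f y n, OF that] unfolding F_def by blast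
  ultimately show ?thesis by blast
qed

lemma infnorm_matrix_vector_le_abs_sum:
  fixes A :: "real^'n::finite^'m::finite"
  assumes "infnorm x \<le> 1"
  shows "infnorm (A *v x) \<le> (\<Sum>i\<in>UNIV. \<Sum>j\<in>UNIV. \<bar>A $ i $ j\<bar>)"
proof -
  have "\<bar>(A *v x) $ i\<bar> \<le> (\<Sum>i\<in>UNIV. \<Sum>j\<in>UNIV. \<bar>A $ i $ j\<bar>)" for i
  proof -
    have "\<bar>(A *v x) $ i\<bar> \<le> (\<Sum>j\<in>UNIV. \<bar>A $ i $ j\<bar> * \<bar>x $ j\<bar>)"
      unfolding matrix_vector_mult_def by (simp add: sum_abs[THEN order_trans] abs_mult)
    also have "\<dots> \<le> (\<Sum>j\<in>UNIV. \<bar>A $ i $ j\<bar>)"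
      using component_le_infnorm_cart[of x] assms
      by (intro sum_mono mult_left_le) (auto intro: order_trans)
    also have "\<dots> \<le> (\<Sum>i\<in>UNIV. \<Sum>j\<in>UNIV. \<bar>A $ i $ j\<bar>)"
      by (intro member_le_sum sum_nonneg) auto
    finally show ?thesis .
  qed
  then show ?thesis
    by (simp add: infnorm_cart cSup_eq_Max full_SetCompr_eq)
qed

lemma bdd_above_induced_supnorm:
  fixes A :: "real^'n::finite^'m::finite"
  shows "bdd_above ((\<lambda>x. supnorm (A *v x)) ` {x. supnorm x \<le> 1})"
  by (rule bdd_aboveI[of _ "\<Sum>i\<in>UNIV. \<Sum>j\<in>UNIV. \<bar>A $ i $ j\<bar>"])
     (auto simp: supnorm_eq_infnorm intro: infnorm_matrix_vector_le_abs_sum)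

lemma infnorm_matrix_vector_le_induced:
  fixes A :: "real^'n::finite^'m::finite"
  assumes "infnorm x \<le> 1"
  shows "infnorm (A *v x) \<le> induced_supnorm A"
  unfolding induced_supnorm_def using assms
  by (intro cSUP_upper2[OF bdd_above_induced_supnorm, of x]) (auto simp: supnorm_eq_infnorm)

lemma induced_supnorm_nonneg: "0 \<le> induced_supnorm (A :: real^'n::finite^'m::finite)"
  using infnorm_matrix_vector_le_induced[of 0 A] by (simp add: infnorm_0)

lemma infnorm_matrix_vector_le:
  fixes A :: "real^'n::finite^'m::finite"
  shows "infnorm (A *v x) \<le> induced_supnorm A * infnorm x"
proof (cases "x = 0")
  case False
  then have pos: "0 < infnorm x" by (simp add: infnorm_pos_lt)
  have "infnorm (A *v x) / infnorm x = infnorm (A *v ((1 / infnorm x) *\<^sub>R x))"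
    using pos by (simp add: matrix_vector_mult_scaleR infnorm_mul)
  also have "\<dots> \<le> induced_supnorm A"
    using pos by (intro infnorm_matrix_vector_le_induced) (simp add: infnorm_mul)
  finally show ?thesis using pos by (simp add: pos_divide_le_eq)
qed (simp add: infnorm_0)

lemma inner_matrix_vector_transpose:
  fixes A :: "real^'n::finite^'m::finite"
  shows "(A *v x) \<bullet> y = x \<bullet> (transpose A *v y)"
  by (metis dot_lmul_matrix inner_commute transpose_matrix_vector)

lemma invertible_gram_matrix:
  fixes A :: "real^'n::finite^'m::finite"
  assumes "rank A = CARD('n)"
  shows "invertible (transpose A ** A)"
proof -
  have "inj ((*v) A)"
    using assms by (simp add: full_rank_injective)
  have "z = 0" if "(transpose A ** A) *v z = 0" for z
  proof -
    have "(A *v z) \<bullet> (A *v z) = 0"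
      using that by (simp add: inner_matrix_vector_transpose matrix_vector_mul_assoc)
    then have "A *v z = A *v 0" by simp
    with \<open>inj ((*v) A)\<close> show "z = 0" by (rule injD)
  qed
  then have "inj ((*v) (transpose A ** A))"
    by (intro injI) (metis eq_iff_diff_eq_0 matrix_vector_mult_diff_distrib)
  then show ?thesis
    by (simp add: invertible_left_inverse matrix_left_invertible_injective)
qed

lemma matrix_mul_matrix_inv:
  assumes "invertible A"
  shows "A ** matrix_inv A = mat 1"
  using someI_ex[OF assms[unfolded invertible_def]] by (simp add: matrix_inv_def)

text \<open>With R the rows of \<Phi> in D (padded by zero rows), the residual of the solution \<theta>ls
  of the normal equations is orthogonal to the range of R; by Pythagoras every minimiser \<theta>
  has R (\<theta> - \<theta>ls) = 0, and R is injective.\<close>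
lemma least_squares_eq_Mproj:
  fixes \<Phi> :: "real^'d::finite^'s::finite"
  assumes rank: "rank (restrict_rows D \<Phi>) = CARD('d)"
    and min: "\<And>t. (\<Sum>s\<in>D. ((\<Phi> *v \<theta>) $ s - y $ s)\<^sup>2) \<le> (\<Sum>s\<in>D. ((\<Phi> *v t) $ s - y $ s)\<^sup>2)"
  shows "\<Phi> *v \<theta> = Mproj D \<Phi> *v y"
proof -
  define R where "R = restrict_rows D \<Phi>"
  define yD where "yD = (\<chi> s. if s \<in> D then y $ s else 0)"
  define \<theta>ls where "\<theta>ls = matrix_inv (transpose R ** R) *v (transpose R *v yD)"
  have RyD: "transpose R *v yD = transpose R *v y"
    unfolding R_def yD_def
    by (simp add: vec_eq_iff matrix_vector_mult_def restrict_rows_def transpose_def)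
       (intro allI sum.cong, auto)
  have objective: "(\<Sum>s\<in>D. ((\<Phi> *v t) $ s - y $ s)\<^sup>2) = (norm (R *v t - yD))\<^sup>2" for t
  proof -
    have "((R *v t - yD) $ s)\<^sup>2 = (if s \<in> D then ((\<Phi> *v t) $ s - y $ s)\<^sup>2 else 0)" for s
      by (simp add: R_def yD_def restrict_rows_def matrix_vector_mult_def)
    then show ?thesis
      by (simp add: power2_norm_eq_inner inner_vec_def sum.If_cases flip: power2_eq_square)
  qed
  have "transpose R *v (R *v \<theta>ls) = transpose R *v yD"
    using matrix_mul_matrix_inv[OF invertible_gram_matrix[OF rank[folded R_def]]]
    by (metis \<theta>ls_def matrix_mul_assoc matrix_vector_mul_assoc matrix_vector_mul_lid)
  then have normal: "orthogonal (R *v z) (R *v \<theta>ls - yD)" for z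
    by (simp add: orthogonal_def inner_matrix_vector_transpose matrix_vector_mult_diff_distrib)
  have "(norm (R *v \<theta> - yD))\<^sup>2 = (norm (R *v (\<theta> - \<theta>ls)))\<^sup>2 + (norm (R *v \<theta>ls - yD))\<^sup>2"
    using norm_add_Pythagorean[OF normal[of "\<theta> - \<theta>ls"]]
    by (simp add: matrix_vector_mult_diff_distrib)
  moreover have "(norm (R *v \<theta> - yD))\<^sup>2 \<le> (norm (R *v \<theta>ls - yD))\<^sup>2"
    using min[of \<theta>ls] by (simp add: objective)
  ultimately have "R *v (\<theta> - \<theta>ls) = R *v 0"
    by simp
  moreover have "inj ((*v) R)"
    using rank by (simp add: R_def full_rank_injective)
  ultimately have "\<theta> = \<theta>ls"
    by (metis injD eq_iff_diff_eq_0)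
  then show ?thesis
    using RyD by (simp add: Mproj_def R_def[symmetric] \<theta>ls_def flip: matrix_vector_mul_assoc)
qed

lemma infnorm_cart_le: "(\<And>i. \<bar>x $ i\<bar> \<le> b) \<Longrightarrow> infnorm (x :: real^'n::finite) \<le> b"
  unfolding infnorm_cart by (rule cSup_least) auto

lemma prob_simplex_nonempty:
  assumes "finite A" "A \<noteq> {}"
  shows "prob_simplex A \<noteq> {}"
proof -
  obtain a where "a \<in> A" using assms by blast
  then have "(\<lambda>x. if x = a then 1 else 0) \<in> prob_simplex A"
    using assms by (auto simp: prob_simplex_def)
  then show ?thesis by blast
qed

lemma bilin_diff: "bilin U V p A q - bilin U V p B q = bilin U V p (\<lambda>u v. A u v - B u v) q"
  unfolding bilin_def by (simp add: sum_subtractf algebra_simps)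

lemma abs_bilin_le:
  assumes p: "p \<in> prob_simplex U" and q: "q \<in> prob_simplex V"
    and C: "\<And>u v. u \<in> U \<Longrightarrow> v \<in> V \<Longrightarrow> \<bar>C u v\<bar> \<le> b"
  shows "\<bar>bilin U V p C q\<bar> \<le> b"
proof -
  have p0: "\<And>u. 0 \<le> p u" and p1: "sum p U = 1" and q0: "\<And>v. 0 \<le> q v" and q1: "sum q V = 1"
    using p q by (auto simp: prob_simplex_def)
  have "\<bar>bilin U V p C q\<bar> \<le> (\<Sum>u\<in>U. \<Sum>v\<in>V. \<bar>p u * C u v * q v\<bar>)"
    unfolding bilin_def by (rule order_trans[OF sum_abs sum_mono[OF sum_abs]])
  also have "\<dots> \<le> (\<Sum>u\<in>U. \<Sum>v\<in>V. p u * b * q v)"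
    using p0 q0 C by (intro sum_mono) (simp add: abs_mult mult_left_mono mult_right_mono)
  also have "\<dots> = b"
    using p1 q1 by (simp flip: sum_distrib_left sum_distrib_right add: mult.commute)
  finally show ?thesis .
qed

lemma SUP_INF_le_shift:
  fixes f h :: "'a \<Rightarrow> 'b \<Rightarrow> real"
  assumes P: "P \<noteq> {}" and Q: "Q \<noteq> {}"
    and bounded: "\<And>p q. p \<in> P \<Longrightarrow> q \<in> Q \<Longrightarrow> \<bar>f p q\<bar> \<le> B \<and> \<bar>h p q\<bar> \<le> B"
    and le: "\<And>p q. p \<in> P \<Longrightarrow> q \<in> Q \<Longrightarrow> f p q \<le> h p q + e"
  shows "(SUP p\<in>P. INF q\<in>Q. f p q) \<le> (SUP p\<in>P. INF q\<in>Q. h p q) + e"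
proof (rule cSUP_least[OF P])
  fix p assume p: "p \<in> P"
  obtain q0 where q0: "q0 \<in> Q" using Q by blast
  have bdd_f: "bdd_below (f p ` Q)" and bdd_h: "bdd_below (h p' ` Q)" if "p' \<in> P" for p'
    using bounded p that by (fastforce intro!: bdd_belowI[of _ "-B"] simp: abs_le_iff)+
  have "(INF q\<in>Q. f p q) - e \<le> (INF q\<in>Q. h p q)"
    by (intro cINF_greatest[OF Q])
       (metis cINF_lower[OF bdd_f[OF p]] diff_le_eq le[OF p] order_trans)
  also have "(INF q\<in>Q. h p q) \<le> (SUP p\<in>P. INF q\<in>Q. h p q)"
  proof (rule cSUP_upper[OF p], rule bdd_aboveI)
    fix x assume "x \<in> (\<lambda>p. INF q\<in>Q. h p q) ` P"
    then obtain p' where "p' \<in> P" "x = (INF q\<in>Q. h p' q)" by blast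
    then show "x \<le> B"
      using cINF_lower[OF bdd_h q0] bounded[OF _ q0] by (metis abs_le_D1 order_trans)
  qed
  finally show "(INF q\<in>Q. f p q) \<le> (SUP p\<in>P. INF q\<in>Q. h p q) + e" by simp
qed

locale zero_sum_game =
  fixes Uset :: "'s::finite \<Rightarrow> 'u set" and Vset :: "'s \<Rightarrow> 'v set"
    and Pr :: "'s \<Rightarrow> 'u \<Rightarrow> 'v \<Rightarrow> 's \<Rightarrow> real" and g :: "'s \<Rightarrow> 'u \<Rightarrow> 'v \<Rightarrow> real"
    and \<alpha> :: real
  assumes game: "markov_game Uset Vset Pr g \<alpha>"
begin

abbreviation "T \<equiv> Tbell Uset Vset Pr g \<alpha>"
abbreviation "Tp \<equiv> Tpol Uset Vset Pr g \<alpha>"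
abbreviation "Jp \<equiv> Jpol Uset Vset Pr g \<alpha>"
abbreviation "Jopt \<equiv> Jstar Uset Vset Pr g \<alpha>"

lemma discount_pos: "0 < \<alpha>" and discount_less_1: "\<alpha> < 1"
  using game by (auto simp: markov_game_def)

lemma action_simplices_nonempty: "prob_simplex (Uset s) \<noteq> {}" "prob_simplex (Vset s) \<noteq> {}"
  using game prob_simplex_nonempty unfolding markov_game_def by blast+

lemma abs_Amat_diff_le:
  assumes "u \<in> Uset s" "v \<in> Vset s"
  shows "\<bar>Amat Pr g \<alpha> J s u v - Amat Pr g \<alpha> J' s u v\<bar> \<le> \<alpha> * infnorm (J - J')"
proof -
  have Pr: "\<And>s'. 0 \<le> Pr s u v s'" "(\<Sum>s'\<in>UNIV. Pr s u v s') = 1"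
    using game assms by (auto simp: markov_game_def)
  have "Amat Pr g \<alpha> J s u v - Amat Pr g \<alpha> J' s u v = \<alpha> * (\<Sum>s'\<in>UNIV. Pr s u v s' * (J - J') $ s')"
    by (simp add: Amat_def algebra_simps sum_subtractf)
  moreover have "\<bar>\<Sum>s'\<in>UNIV. Pr s u v s' * (J - J') $ s'\<bar> \<le> (\<Sum>s'\<in>UNIV. Pr s u v s' * infnorm (J - J'))"
    using Pr(1) component_le_infnorm_cart[of "J - J'"]
    by (intro order_trans[OF sum_abs sum_mono]) (simp add: abs_mult mult_left_mono)
  moreover have "(\<Sum>s'\<in>UNIV. Pr s u v s' * infnorm (J - J')) = infnorm (J - J')"
    using Pr(2) by (simp flip: sum_distrib_right)
  ultimately show ?thesis
    using discount_pos by (simp add: abs_mult)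
qed

lemma abs_Amat_le:
  assumes "u \<in> Uset s" "v \<in> Vset s"
  shows "\<bar>Amat Pr g \<alpha> J s u v\<bar> \<le> 1 + \<alpha> * infnorm J"
proof -
  have "\<bar>g s u v\<bar> \<le> 1"
    using game assms by (auto simp: markov_game_def)
  moreover have "Amat Pr g \<alpha> J s u v = g s u v + (Amat Pr g \<alpha> J s u v - Amat Pr g \<alpha> 0 s u v)"
    by (simp add: Amat_def)
  ultimately show ?thesis
    using abs_Amat_diff_le[OF assms, of J 0] by (simp add: infnorm_0)
qed

lemma Tpol_lipschitz:
  assumes "policy_pair Uset Vset \<mu> \<nu>"
  shows "infnorm (Tp \<mu> \<nu> J - Tp \<mu> \<nu> J') \<le> \<alpha> * infnorm (J - J')"
proof (rule infnorm_cart_le)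
  fix s
  have "\<mu> s \<in> prob_simplex (Uset s)" "\<nu> s \<in> prob_simplex (Vset s)"
    using assms by (auto simp: policy_pair_def)
  then show "\<bar>(Tp \<mu> \<nu> J - Tp \<mu> \<nu> J') $ s\<bar> \<le> \<alpha> * infnorm (J - J')"
    unfolding Tpol_def by (simp add: bilin_diff abs_bilin_le abs_Amat_diff_le)
qed

lemma Tpol_bound:
  assumes "policy_pair Uset Vset \<mu> \<nu>"
  shows "infnorm (Tp \<mu> \<nu> J) \<le> 1 + \<alpha> * infnorm J"
proof (rule infnorm_cart_le)
  fix s
  have "\<mu> s \<in> prob_simplex (Uset s)" "\<nu> s \<in> prob_simplex (Vset s)"
    using assms by (auto simp: policy_pair_def)
  then show "\<bar>Tp \<mu> \<nu> J $ s\<bar> \<le> 1 + \<alpha> * infnorm J"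
    unfolding Tpol_def by (simp add: abs_bilin_le abs_Amat_le)
qed

lemma Tbell_lipschitz: "infnorm (T J - T J') \<le> \<alpha> * infnorm (J - J')"
proof (rule infnorm_cart_le)
  fix s
  let ?P = "prob_simplex (Uset s)" and ?Q = "prob_simplex (Vset s)"
  let ?f = "\<lambda>J p q. bilin (Uset s) (Vset s) p (Amat Pr g \<alpha> J s) q"
  let ?B = "1 + \<alpha> * infnorm J + \<alpha> * infnorm J'" and ?e = "\<alpha> * infnorm (J - J')"
  have "0 \<le> \<alpha> * infnorm J" "0 \<le> \<alpha> * infnorm J'"
    using discount_pos by (simp_all add: infnorm_pos_le)
  then have entries: "\<bar>Amat Pr g \<alpha> J s u v\<bar> \<le> ?B" "\<bar>Amat Pr g \<alpha> J' s u v\<bar> \<le> ?B"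
    if "u \<in> Uset s" "v \<in> Vset s" for u v
    using abs_Amat_le[OF that, of J] abs_Amat_le[OF that, of J'] by linarith+
  have bounded: "\<bar>?f J p q\<bar> \<le> ?B \<and> \<bar>?f J' p q\<bar> \<le> ?B" if "p \<in> ?P" "q \<in> ?Q" for p q
    using that entries by (simp add: abs_bilin_le)
  have close: "?f J p q \<le> ?f J' p q + ?e \<and> ?f J' p q \<le> ?f J p q + ?e"
    if "p \<in> ?P" "q \<in> ?Q" for p q
  proof -
    have "\<bar>?f J p q - ?f J' p q\<bar> \<le> ?e"
      using that by (simp add: bilin_diff abs_bilin_le abs_Amat_diff_le)
    then show ?thesis by linarith
  qed
  have "(SUP p\<in>?P. INF q\<in>?Q. ?f J p q) \<le> (SUP p\<in>?P. INF q\<in>?Q. ?f J' p q) + ?e"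
    using close by (intro SUP_INF_le_shift[OF action_simplices_nonempty bounded]) blast+
  moreover have "(SUP p\<in>?P. INF q\<in>?Q. ?f J' p q) \<le> (SUP p\<in>?P. INF q\<in>?Q. ?f J p q) + ?e"
    using close bounded by (intro SUP_INF_le_shift[OF action_simplices_nonempty, where B = ?B]) blast+
  ultimately show "\<bar>(T J - T J') $ s\<bar> \<le> ?e"
    by (simp add: Tbell_def abs_le_iff)
qed

lemma Tbell_Jstar: "T Jopt = Jopt"
proof -
  have "\<exists>!J. T J = J"
    using Tbell_lipschitz discount_pos discount_less_1
    by (intro infnorm_contraction_unique_fixpoint) auto
  then show ?thesis unfolding Jstar_def by (rule theI')
qed

lemma Tpol_Jpol:
  assumes "policy_pair Uset Vset \<mu> \<nu>"
  shows "Tp \<mu> \<nu> (Jp \<mu> \<nu>) = Jp \<mu> \<nu>"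
proof -
  have "\<exists>!J. Tp \<mu> \<nu> J = J"
    using Tpol_lipschitz[OF assms] discount_pos discount_less_1
    by (intro infnorm_contraction_unique_fixpoint) auto
  then show ?thesis unfolding Jpol_def by (rule theI')
qed

lemma infnorm_Jpol_le:
  assumes "policy_pair Uset Vset \<mu> \<nu>"
  shows "infnorm (Jp \<mu> \<nu>) \<le> 1 / (1 - \<alpha>)"
  using Tpol_bound[OF assms, of "Jp \<mu> \<nu>"] discount_less_1
  by (simp add: Tpol_Jpol[OF assms] field_simps)

lemma bdd_above_projection_error:
  assumes "\<And>k. k \<in> K \<Longrightarrow> policy_pair Uset Vset (\<mu> k) (\<nu> k)"
  shows "bdd_above ((\<lambda>k. supnorm (Jp (\<mu> k) (\<nu> k) - M *v Jp (\<mu> k) (\<nu> k))) ` K)"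
proof (rule bdd_aboveI2)
  fix k assume "k \<in> K"
  let ?J = "Jp (\<mu> k) (\<nu> k)"
  have "infnorm (?J - M *v ?J) \<le> infnorm ?J + induced_supnorm M * infnorm ?J"
    using infnorm_triangle[of ?J "- (M *v ?J)"] infnorm_matrix_vector_le[of M ?J]
    by (simp add: infnorm_neg)
  also have "\<dots> \<le> 1 / (1 - \<alpha>) + induced_supnorm M * (1 / (1 - \<alpha>))"
    using infnorm_Jpol_le[OF assms[OF \<open>k \<in> K\<close>]] induced_supnorm_nonneg[of M]
    by (intro add_mono mult_left_mono)
  finally show "supnorm (?J - M *v ?J) \<le> (1 + induced_supnorm M) * (1 / (1 - \<alpha>))"
    by (simp add: supnorm_eq_infnorm add_divide_distrib)
qed

lemma Jpol_greedy_dist: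
  assumes P: "policy_pair Uset Vset \<mu> \<nu>" and greedy: "Tp \<mu> \<nu> W = T W"
  shows "(1 - \<alpha>) * infnorm (Jp \<mu> \<nu> - Jopt) \<le> 2 * \<alpha> * infnorm (W - Jopt)"
proof -
  let ?J = "Jp \<mu> \<nu>"
  have "?J - Jopt = (Tp \<mu> \<nu> ?J - Tp \<mu> \<nu> W) + (T W - T Jopt)"
    using Tpol_Jpol[OF P] greedy Tbell_Jstar by simp
  then have "infnorm (?J - Jopt) \<le> infnorm (Tp \<mu> \<nu> ?J - Tp \<mu> \<nu> W) + infnorm (T W - T Jopt)"
    by (metis infnorm_triangle)
  also have "\<dots> \<le> \<alpha> * infnorm (?J - W) + \<alpha> * infnorm (W - Jopt)"
    by (intro add_mono Tpol_lipschitz[OF P] Tbell_lipschitz)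
  also have "\<alpha> * infnorm (?J - W) \<le> \<alpha> * (infnorm (?J - Jopt) + infnorm (W - Jopt))"
    using infnorm_triangle[of "?J - Jopt" "Jopt - W"] discount_pos
    by (intro mult_left_mono) (simp_all add: infnorm_sub[of Jopt W])
  finally show ?thesis by (simp add: algebra_simps)
qed

lemma approximate_iteration_step:
  assumes P: "policy_pair Uset Vset \<mu> \<nu>" and greedy: "Tp \<mu> \<nu> W = T W"
    and approx: "infnorm (Jp \<mu> \<nu> - M *v Jp \<mu> \<nu>) \<le> \<delta>"
  shows "infnorm (M *v (Tp \<mu> \<nu> ^^ m) W - Jopt)
           \<le> (induced_supnorm M * \<alpha> ^ m + 1) * ((1 + \<alpha>) / (1 - \<alpha>)) * infnorm (W - Jopt) + \<delta>"
proof -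
  let ?J = "Jp \<mu> \<nu>" and ?c = "(1 + \<alpha>) / (1 - \<alpha>)"
  define a where "a = infnorm (W - Jopt)"
  define d where "d = infnorm (?J - Jopt)"
  have "(1 - \<alpha>) * (a + d) \<le> (1 + \<alpha>) * a"
    using Jpol_greedy_dist[OF P greedy] unfolding a_def d_def by (simp add: algebra_simps)
  then have ad: "a + d \<le> ?c * a"
    using discount_less_1 by (simp add: field_simps)
  let ?A = "M *v ((Tp \<mu> \<nu> ^^ m) W - (Tp \<mu> \<nu> ^^ m) ?J)"
  have "infnorm ?A \<le> induced_supnorm M * infnorm ((Tp \<mu> \<nu> ^^ m) W - (Tp \<mu> \<nu> ^^ m) ?J)"
    by (rule infnorm_matrix_vector_le)
  also have "\<dots> \<le> induced_supnorm M * (\<alpha> ^ m * infnorm (W - ?J))"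
    using Tpol_lipschitz[OF P] discount_pos
    by (intro mult_left_mono infnorm_funpow_le induced_supnorm_nonneg) auto
  also have "\<dots> \<le> induced_supnorm M * (\<alpha> ^ m * (a + d))"
    using infnorm_triangle[of "W - Jopt" "Jopt - ?J"] discount_pos
    by (intro mult_left_mono induced_supnorm_nonneg)
       (simp_all add: a_def d_def infnorm_sub[of Jopt])
  finally have A: "infnorm ?A \<le> induced_supnorm M * \<alpha> ^ m * (a + d)"
    by (simp add: mult.assoc)
  have split: "M *v (Tp \<mu> \<nu> ^^ m) W - Jopt = ?A + (M *v ?J - ?J) + (?J - Jopt)"
    using funpow_fixpoint[of "Tp \<mu> \<nu>", OF Tpol_Jpol[OF P]] by (simp add: matrix_vector_mult_diff_distrib)
  have "infnorm (M *v (Tp \<mu> \<nu> ^^ m) W - Jopt) \<le> infnorm ?A + infnorm (M *v ?J - ?J) + d"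
    using infnorm_triangle[of "?A + (M *v ?J - ?J)" "?J - Jopt"] infnorm_triangle[of ?A "M *v ?J - ?J"]
    unfolding split d_def by linarith
  also have "\<dots> \<le> induced_supnorm M * \<alpha> ^ m * (a + d) + \<delta> + d"
    using A approx infnorm_sub[of "M *v ?J" ?J] by linarith
  also have "\<dots> \<le> induced_supnorm M * \<alpha> ^ m * (?c * a) + ?c * a + \<delta>"
  proof -
    have "0 \<le> induced_supnorm M * \<alpha> ^ m"
      using induced_supnorm_nonneg[of M] discount_pos by simp
    then have "induced_supnorm M * \<alpha> ^ m * (a + d) \<le> induced_supnorm M * \<alpha> ^ m * (?c * a)"
      by (rule mult_left_mono[OF ad])
    moreover have "d \<le> ?c * a"
      using ad infnorm_pos_le[of "W - Jopt"] unfolding a_def by linarith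
    ultimately show ?thesis by linarith
  qed
  also have "\<dots> = (induced_supnorm M * \<alpha> ^ m + 1) * ?c * infnorm (W - Jopt) + \<delta>"
    unfolding a_def by (simp only: distrib_right mult_1_left mult.assoc)
  finally show ?thesis .
qed

lemma lookahead_iteration_step:
  assumes P: "policy_pair Uset Vset \<mu> \<nu>" and H: "1 \<le> H"
    and greedy: "Tp \<mu> \<nu> ((T ^^ (H - 1)) x) = (T ^^ H) x"
    and approx: "infnorm (Jp \<mu> \<nu> - M *v Jp \<mu> \<nu>) \<le> \<delta>"
  shows "infnorm (M *v (Tp \<mu> \<nu> ^^ m) ((T ^^ (H - 1)) x) - Jopt)
           \<le> (\<alpha> ^ (H - 1) + (induced_supnorm M * \<alpha> ^ (m + H - 1) + \<alpha> ^ (H - 1)) * (1 + \<alpha>) / (1 - \<alpha>))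
               * infnorm (x - Jopt) + \<delta>"
proof -
  let ?W = "(T ^^ (H - 1)) x" and ?K = "(induced_supnorm M * \<alpha> ^ m + 1) * ((1 + \<alpha>) / (1 - \<alpha>))"
  have "(T ^^ H) x = T ?W"
    using H by (metis Suc_diff_1 comp_apply funpow.simps(2) less_eq_Suc_le One_nat_def)
  then have "infnorm (M *v (Tp \<mu> \<nu> ^^ m) ?W - Jopt) \<le> ?K * infnorm (?W - Jopt) + \<delta>"
    using greedy by (intro approximate_iteration_step[OF P _ approx]) simp
  also have "\<dots> \<le> ?K * (\<alpha> ^ (H - 1) * infnorm (x - Jopt)) + \<delta>"
  proof -
    have "infnorm (?W - Jopt) \<le> \<alpha> ^ (H - 1) * infnorm (x - Jopt)"
      using infnorm_funpow_le[OF Tbell_lipschitz, of "H - 1" x Jopt] discount_pos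
      by (simp add: funpow_fixpoint[of T, OF Tbell_Jstar])
    moreover have "0 \<le> ?K"
      using induced_supnorm_nonneg[of M] discount_pos discount_less_1 by simp
    ultimately show ?thesis
      by (intro add_right_mono mult_left_mono)
  qed
  also have "\<dots> \<le> (\<alpha> ^ (H - 1) + (induced_supnorm M * \<alpha> ^ (m + H - 1) + \<alpha> ^ (H - 1)) * (1 + \<alpha>) / (1 - \<alpha>))
                   * infnorm (x - Jopt) + \<delta>"
  proof -
    have "m + H - 1 = m + (H - 1)" using H by simp
    then have "(induced_supnorm M * \<alpha> ^ (m + H - 1) + \<alpha> ^ (H - 1)) * (1 + \<alpha>) / (1 - \<alpha>) = ?K * \<alpha> ^ (H - 1)"
      by (simp add: power_add algebra_simps add_divide_distrib)
    moreover have "0 \<le> \<alpha> ^ (H - 1) * infnorm (x - Jopt)"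
      using discount_pos by (simp add: infnorm_pos_le)
    ultimately show ?thesis by (simp add: algebra_simps)
  qed
  finally show ?thesis .
qed

end

lemma affine_recursion_bound:
  fixes e :: "nat \<Rightarrow> real"
  assumes step: "\<And>k. e (Suc k) \<le> \<kappa> * e k + c" and \<kappa>: "0 \<le> \<kappa>" "\<kappa> < 1" and "0 \<le> c"
  shows "e k \<le> \<kappa> ^ k * e 0 + c / (1 - \<kappa>)"
proof (induction k)
  case 0
  show ?case using \<kappa> \<open>0 \<le> c\<close> by simp
next
  case (Suc k)
  have "e (Suc k) \<le> \<kappa> * (\<kappa> ^ k * e 0 + c / (1 - \<kappa>)) + c"
    using step[of k] mult_left_mono[OF Suc \<kappa>(1)] by linarith
  also have "\<dots> = \<kappa> ^ Suc k * e 0 + c / (1 - \<kappa>)"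
    using \<kappa> by (simp add: field_simps)
  finally show ?case .
qed

lemma limsup_le_of_geometric_bound:
  fixes e :: "nat \<Rightarrow> real"
  assumes "\<And>k. e k \<le> \<kappa> ^ k * b + c" and "0 \<le> \<kappa>" "\<kappa> < 1"
  shows "limsup (\<lambda>k. ereal (e k)) \<le> ereal c"
proof -
  have "(\<lambda>k. \<kappa> ^ k * b + c) \<longlonglongrightarrow> 0 * b + c"
    using assms by (intro tendsto_intros) simp
  then have "limsup (\<lambda>k. ereal (\<kappa> ^ k * b + c)) = ereal c"
    by (intro lim_imp_Limsup) (simp_all add: tendsto_ereal)
  moreover have "limsup (\<lambda>k. ereal (e k)) \<le> limsup (\<lambda>k. ereal (\<kappa> ^ k * b + c))"
    using assms by (intro Limsup_mono) simp
  ultimately show ?thesis by simp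
qed

theorem theorem2:
  fixes Uset :: "'s::finite \<Rightarrow> 'u set" and Vset :: "'s \<Rightarrow> 'v set"
    and Pr :: "'s \<Rightarrow> 'u \<Rightarrow> 'v \<Rightarrow> 's \<Rightarrow> real" and g :: "'s \<Rightarrow> 'u \<Rightarrow> 'v \<Rightarrow> real"
    and \<alpha> :: real and H m :: nat
    and \<Phi> :: "real^'d::finite^'s" and D :: "'s set"
    and \<theta> :: "nat \<Rightarrow> real^'d"
    and \<mu> :: "nat \<Rightarrow> 's \<Rightarrow> 'u \<Rightarrow> real" and \<nu> :: "nat \<Rightarrow> 's \<Rightarrow> 'v \<Rightarrow> real"
    and \<delta>FV \<delta>app \<kappa> :: real
  assumes game: "markov_game Uset Vset Pr g \<alpha>"
    and H: "H \<ge> 1" and m: "m \<ge> 1"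
    and rank: "rank (restrict_rows D \<Phi>) = CARD('d)"
    and pol: "\<And>k. policy_pair Uset Vset (\<mu> (Suc k)) (\<nu> (Suc k))"
    and greedy: "\<And>k. Tpol Uset Vset Pr g \<alpha> (\<mu> (Suc k)) (\<nu> (Suc k))
                        ((Tbell Uset Vset Pr g \<alpha> ^^ (H - 1)) (\<Phi> *v \<theta> k))
                    = (Tbell Uset Vset Pr g \<alpha> ^^ H) (\<Phi> *v \<theta> k)"
    and lsq: "\<And>k \<theta>'. (\<Sum>s\<in>D. ((\<Phi> *v \<theta> (Suc k)) $ s
                  - ((Tpol Uset Vset Pr g \<alpha> (\<mu> (Suc k)) (\<nu> (Suc k)) ^^ m)
                       ((Tbell Uset Vset Pr g \<alpha> ^^ (H - 1)) (\<Phi> *v \<theta> k))) $ s)\<^sup>2)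
               \<le> (\<Sum>s\<in>D. ((\<Phi> *v \<theta>') $ s
                  - ((Tpol Uset Vset Pr g \<alpha> (\<mu> (Suc k)) (\<nu> (Suc k)) ^^ m)
                       ((Tbell Uset Vset Pr g \<alpha> ^^ (H - 1)) (\<Phi> *v \<theta> k))) $ s)\<^sup>2)"
    and dFV: "\<delta>FV = induced_supnorm (Mproj D \<Phi>)"
    and dapp: "\<delta>app = (SUP k\<in>{1..}. supnorm (Jpol Uset Vset Pr g \<alpha> (\<mu> k) (\<nu> k)
                   - Mproj D \<Phi> *v Jpol Uset Vset Pr g \<alpha> (\<mu> k) (\<nu> k)))"
    and kappa: "\<kappa> = \<alpha> ^ (H - 1) + (\<delta>FV * \<alpha> ^ (m + H - 1) + \<alpha> ^ (H - 1)) * (1 + \<alpha>) / (1 - \<alpha>)"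
    and kappa_lt: "\<kappa> < 1"
  shows "(\<forall>k. supnorm (\<Phi> *v \<theta> k - Jstar Uset Vset Pr g \<alpha>)
            \<le> \<kappa> ^ k * supnorm (\<Phi> *v \<theta> 0 - Jstar Uset Vset Pr g \<alpha>) + \<delta>app / (1 - \<kappa>))
         \<and> limsup (\<lambda>k. ereal (supnorm (\<Phi> *v \<theta> k - Jstar Uset Vset Pr g \<alpha>)))
            \<le> ereal (\<delta>app / (1 - \<kappa>))"
proof -
  interpret zero_sum_game Uset Vset Pr g \<alpha>
    by (rule zero_sum_game.intro[OF game])
  let ?M = "Mproj D \<Phi>"
  define e where "e k = supnorm (\<Phi> *v \<theta> k - Jopt)" for k
  have approx: "infnorm (Jp (\<mu> (Suc k)) (\<nu> (Suc k)) - ?M *v Jp (\<mu> (Suc k)) (\<nu> (Suc k))) \<le> \<delta>app" for k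
    unfolding dapp supnorm_eq_infnorm[symmetric]
    using pol by (intro cSUP_upper bdd_above_projection_error) (auto simp: Suc_le_eq gr0_conv_Suc)
  have step: "e (Suc k) \<le> \<kappa> * e k + \<delta>app" for k
    using lookahead_iteration_step[OF pol H greedy approx, of m]
      least_squares_eq_Mproj[OF rank lsq]
    by (simp add: e_def kappa dFV supnorm_eq_infnorm)
  have "0 \<le> \<delta>app"
    using approx[of 0] infnorm_pos_le order_trans by blast
  moreover have "0 \<le> \<kappa>"
    unfolding kappa dFV using discount_pos discount_less_1 induced_supnorm_nonneg
    by (intro add_nonneg_nonneg divide_nonneg_nonneg mult_nonneg_nonneg) auto
  ultimately have bound: "e k \<le> \<kappa> ^ k * e 0 + \<delta>app / (1 - \<kappa>)" for k
    using affine_recursion_bound[of e, OF step] kappa_lt by blast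
  then show ?thesis
    using limsup_le_of_geometric_bound[OF bound \<open>0 \<le> \<kappa>\<close> kappa_lt] by (simp add: e_def)
qed

end
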